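(* There is no stable base $\mathcal{B}$ such that the law $A\Rightarrow_\rho B,\ A\ \vdash_\rho\ B$ holds (i.e. is true for all algorithmic statements $A,B$) for all $\mathcal{B}$-libraries $\rho$. In particular, no stable base contains Rule $P_3$, the rule implementing the diagram $A\Rightarrow_\rho B,\ A\,/\,B$.
   Context: Framework. Algorithms are recursive algorithms in a fixed standard model. A datum is anything that can be input to an algorithm; data include natural numbers and algorithms, and every finite list of data is a datum. Every algorithm accepts exactly one input datum and either does not halt or halts with exactly one output datum. Every datum has a positive integer size, only finitely many data have a given size, and the size of a list is strictly greater than the sum of the sizes of its items. A process is a pair (algorithm, input). Every halting process has a positive integer runtime; if a process runs subprocesses in its execution, its runtime is strictly greater than the sum of the runtimes of the halting subprocesses. An algorithmic statement is a datum $[\alpha,u,v]$ with $\alpha$ an algorithm, asserting that $\alpha$ with input $u$ halts with output $v$; it is true if this is so and false otherwise. To say that an algorithmic statement holds is to say that it is true. Rules and libraries. An algorithmic sequence is an algorithm $\rho$ that halts on every positive integer $n$; its output is written $\rho_n$. A rule is an algorithm which, on every input $[H,\rho,m]$ with $H$ a finite list of algorithmic statements (hypothesis list), $\rho$ an algorithmic sequence (nominal library) and $m$ a positive integer (resource integer), halts and outputs a list of algorithmic statements (conclusion list) having $H$ as an initial sublist, and which is monotone: if $m'\ge m$ and every item of $H$ is an item of $H'$, then every item of the output on $[H,\rho,m]$ is an item of the output on $[H',\rho,m']$. A library is an algorithmic sequence $\rho$ such that every $\rho_n$ is a rule (not necessarily distinct); the $\rho_n$ are the rules contained in $\rho$.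 A rule is $\rho$-valid if for every list $H$ of true statements and every $m$, its output on $[H,\rho,m]$ consists only of true statements. A library $\rho$ is valid if all its rules are $\rho$-valid. Bases. A base is a set $\mathcal{B}$ of rules that is finite or is the set of terms of a library. A $\mathcal{B}$-library is a library containing all rules of $\mathcal{B}$. A $\mathcal{B}$-library $\rho$ is valid outside $\mathcal{B}$ if every rule in $\rho$ which is not in $\mathcal{B}$ is $\rho$-valid. A base $\mathcal{B}$ is stable if every $\mathcal{B}$-library that is valid outside $\mathcal{B}$ is valid. Deduction. Fix a recursive bijection $f:\mathbb{N}_+\to\mathbb{N}_+\times\mathbb{N}_+$. The algorithm $\mathrm{deduce}$, on input $[\Gamma,\rho,B]$ ($\Gamma$ a list of algorithmic statements, $\rho$ a library, $B$ an algorithmic statement), computes lists $H_0=\Gamma,H_1,H_2,\dots$, where for $i>0$ with $f(i)=(k,m)$ the list $H_i$ is the output of $\rho_k$ on $[H_{i-1},\rho,m]$; after computing each $H_i$ it checks whether $B$ is on $H_i$, outputs $1$ if so, and otherwise continues. The algorithmic statement $[\mathrm{deduce},[\Gamma,\rho,B],1]$ is denoted $\Gamma\vdash_\rho B$ (the notation is used for any datum $\rho$), and $A_1,\dots,A_n\vdash_\rho B$ means this with $\Gamma=[A_1,\dots,A_n]$. $A\Rightarrow_\rho B$ denotes $A\vdash_\rho B$. Rule diagrams. A rule implementing "$X_1,\dots,X_r\,/\,Y$" is the algorithm which on input $[H,\rho,m]$ outputs $H$ with $Y$ appended for every instance (letters $A,B$ ranging over algorithmic statements) whose premises $X_1,\dots,X_r$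 are all on $H$; the $\rho$ in $\Rightarrow_\rho$ is the nominal library in the input. *)

theory Defs
  imports Main
begin

section \<open>The model of computation\<close>

text \<open>
  The standard model is fixed to be a WHILE language over hereditarily finite lists. Its data are
  natural numbers, finite lists of data, and algorithms; the three kinds are disjoint. Every
  algorithm takes one datum as input.
  Successor, equality and \<open>While\<close> give all partial recursive functions, \<open>Apply\<close> is the
  universal machine, and \<open>Syntax\<close>/\<open>Build\<close> take algorithms apart and put them together, so
  the full structure of every datum is computationally accessible.
\<close>

datatype datum =
    Num nat
  | Lst "datum list"
  | Alg algorithm
and algorithm =
    Quote datum
  | Ident
  | Successor
  | Prepend algorithm algorithm
  | Head
  | Tail
  | Kind
  | Equal algorithm algorithm
  | Syntax
  | Build
  | Compose algorithm algorithm
  | Cond algorithm algorithm algorithm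
  | While algorithm algorithm
  | Apply algorithm algorithm

primrec kind :: "datum \<Rightarrow> nat" where
  "kind (Num n) = 0"
| "kind (Lst xs) = 1"
| "kind (Alg a) = 2"

primrec syntax_tree :: "algorithm \<Rightarrow> datum" where
  "syntax_tree (Quote d) = Lst [Num 0, d]"
| "syntax_tree Ident = Lst [Num 1]"
| "syntax_tree Successor = Lst [Num 2]"
| "syntax_tree (Prepend a b) = Lst [Num 3, Alg a, Alg b]"
| "syntax_tree Head = Lst [Num 4]"
| "syntax_tree Tail = Lst [Num 5]"
| "syntax_tree Kind = Lst [Num 6]"
| "syntax_tree (Equal a b) = Lst [Num 7, Alg a, Alg b]"
| "syntax_tree Syntax = Lst [Num 8]"
| "syntax_tree Build = Lst [Num 9]"
| "syntax_tree (Compose a b) = Lst [Num 10, Alg a, Alg b]"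
| "syntax_tree (Cond a b c) = Lst [Num 11, Alg a, Alg b, Alg c]"
| "syntax_tree (While a b) = Lst [Num 12, Alg a, Alg b]"
| "syntax_tree (Apply a b) = Lst [Num 13, Alg a, Alg b]"

text \<open>
  \<open>run a u v t\<close>: the process with algorithm \<open>a\<close> and input \<open>u\<close> halts with output \<open>v\<close> and has
  runtime \<open>t\<close>. A process without a derivation does not halt; this includes inputs of the wrong
  shape, such as \<open>Head\<close> on an empty list.
\<close>

inductive run :: "algorithm \<Rightarrow> datum \<Rightarrow> datum \<Rightarrow> nat \<Rightarrow> bool" where
  Quote: "run (Quote d) u d 1"
| Ident: "run Ident u u 1"
| Successor: "run Successor (Num n) (Num (Suc n)) 1"
| Prepend: "run a u x s \<Longrightarrow> run b u (Lst xs) t \<Longrightarrow> run (Prepend a b) u (Lst (x # xs)) (Suc (s + t))"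
| Head: "run Head (Lst (x # xs)) x 1"
| Tail: "run Tail (Lst (x # xs)) (Lst xs) 1"
| Kind: "run Kind u (Num (kind u)) 1"
| Equal: "run a u x s \<Longrightarrow> run b u y t \<Longrightarrow>
    run (Equal a b) u (Num (if x = y then 1 else 0)) (Suc (s + t))"
| Syntax: "run Syntax (Alg a) (syntax_tree a) 1"
| Build: "run Build (syntax_tree a) (Alg a) 1"
| Compose: "run b u x s \<Longrightarrow> run a x v t \<Longrightarrow> run (Compose a b) u v (Suc (s + t))"
| Cond_true: "run a u (Num (Suc n)) s \<Longrightarrow> run b u v t \<Longrightarrow> run (Cond a b c) u v (Suc (s + t))"
| Cond_false: "run a u (Num 0) s \<Longrightarrow> run c u v t \<Longrightarrow> run (Cond a b c) u v (Suc (s + t))"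
| While_stop: "run a u (Num 0) s \<Longrightarrow> run (While a b) u u (Suc s)"
| While_step: "run a u (Num (Suc n)) s \<Longrightarrow> run b u x t \<Longrightarrow> run (While a b) x v r \<Longrightarrow>
    run (While a b) u v (Suc (s + t + r))"
| Apply: "run a u (Alg c) s \<Longrightarrow> run b u x t \<Longrightarrow> run c x v r \<Longrightarrow> run (Apply a b) u v (Suc (s + t + r))"

definition halts_with :: "algorithm \<Rightarrow> datum \<Rightarrow> datum \<Rightarrow> bool" where
  "halts_with a u v \<longleftrightarrow> (\<exists>t. run a u v t)"

lemma syntax_tree_inject: "syntax_tree a = syntax_tree b \<Longrightarrow> a = b"
  by (cases a; cases b) auto

text \<open>Output and runtime are unique.\<close>

lemma run_deterministic: "run a u v t \<Longrightarrow> run a u v' t' \<Longrightarrow> v' = v \<and> t' = t"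
proof (induction arbitrary: v' t' rule: run.induct)
  case (Build a u)
  then show ?case by (auto elim: run.cases dest: syntax_tree_inject)
next
  case (Prepend a u x s b xs t)
  from Prepend.prems show ?case by (cases rule: run.cases) (use Prepend.IH in blast)
next
  case (Equal a u x s b y t)
  from Equal.prems show ?case by (cases rule: run.cases) (use Equal.IH in blast)
next
  case (Compose b u x s a v t)
  from Compose.prems show ?case by (cases rule: run.cases) (use Compose.IH in blast)
next
  case (Cond_true a u n s b v t c)
  from Cond_true.prems show ?case by (cases rule: run.cases) (use Cond_true.IH in blast)+
next
  case (Cond_false a u s c v t b)
  from Cond_false.prems show ?case by (cases rule: run.cases) (use Cond_false.IH in blast)+
next
  case (While_stop a u s b)
  from While_stop.prems show ?case by (cases rule: run.cases) (use While_stop.IH in blast)+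
next
  case (While_step a u n s b x t v r)
  from While_step.prems show ?case by (cases rule: run.cases) (use While_step.IH in blast)+
next
  case (Apply a u c s b x t v r)
  from Apply.prems show ?case by (cases rule: run.cases) (use Apply.IH in blast)
qed (auto elim: run.cases)

lemma runtime_positive: "run a u v t \<Longrightarrow> 0 < t"
  by (induction rule: run.induct) auto

lemma halts_with_unique: "halts_with a u v \<Longrightarrow> halts_with a u v' \<Longrightarrow> v' = v"
  by (auto simp: halts_with_def dest: run_deterministic)

inductive_cases runE:
  "run (Quote d) u v t" "run Ident u v t" "run Successor u v t" "run (Prepend a b) u v t"
  "run Head u v t" "run Tail u v t" "run Kind u v t" "run (Equal a b) u v t"
  "run (Compose a b) u v t" "run (Cond a b c) u v t" "run (Apply a b) u v t"

lemma halts_with_simps [simp]: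
  "halts_with (Quote d) u v \<longleftrightarrow> v = d"
  "halts_with Ident u v \<longleftrightarrow> v = u"
  "halts_with Successor u v \<longleftrightarrow> (\<exists>n. u = Num n \<and> v = Num (Suc n))"
  "halts_with (Prepend a b) u v \<longleftrightarrow>
    (\<exists>x xs. halts_with a u x \<and> halts_with b u (Lst xs) \<and> v = Lst (x # xs))"
  "halts_with Head u v \<longleftrightarrow> (\<exists>xs. u = Lst (v # xs))"
  "halts_with Tail u v \<longleftrightarrow> (\<exists>x xs. u = Lst (x # xs) \<and> v = Lst xs)"
  "halts_with Kind u v \<longleftrightarrow> v = Num (kind u)"
  "halts_with (Equal a b) u v \<longleftrightarrow>
    (\<exists>x y. halts_with a u x \<and> halts_with b u y \<and> v = Num (if x = y then 1 else 0))"
  "halts_with (Compose a b) u v \<longleftrightarrow> (\<exists>x. halts_with b u x \<and> halts_with a x v)"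
  "halts_with (Cond a b c) u v \<longleftrightarrow>
    (\<exists>n. halts_with a u (Num n) \<and> (if n = 0 then halts_with c u v else halts_with b u v))"
  "halts_with (Apply a b) u v \<longleftrightarrow>
    (\<exists>c x. halts_with a u (Alg c) \<and> halts_with b u x \<and> halts_with c x v)"
proof -
  show "halts_with (Quote d) u v \<longleftrightarrow> v = d"
    and "halts_with Ident u v \<longleftrightarrow> v = u"
    and "halts_with Successor u v \<longleftrightarrow> (\<exists>n. u = Num n \<and> v = Num (Suc n))"
    and "halts_with Head u v \<longleftrightarrow> (\<exists>xs. u = Lst (v # xs))"
    and "halts_with Tail u v \<longleftrightarrow> (\<exists>x xs. u = Lst (x # xs) \<and> v = Lst xs)"
    and "halts_with Kind u v \<longleftrightarrow> v = Num (kind u)"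
    unfolding halts_with_def by (blast intro: run.intros elim: runE)+
  show "halts_with (Prepend a b) u v \<longleftrightarrow>
      (\<exists>x xs. halts_with a u x \<and> halts_with b u (Lst xs) \<and> v = Lst (x # xs))"
    unfolding halts_with_def by (blast intro: run.Prepend elim: runE)
  show "halts_with (Equal a b) u v \<longleftrightarrow>
      (\<exists>x y. halts_with a u x \<and> halts_with b u y \<and> v = Num (if x = y then 1 else 0))"
    unfolding halts_with_def by (blast intro: run.Equal elim: runE)
  show "halts_with (Compose a b) u v \<longleftrightarrow> (\<exists>x. halts_with b u x \<and> halts_with a x v)"
    unfolding halts_with_def by (blast intro: run.Compose elim: runE)
  show "halts_with (Apply a b) u v \<longleftrightarrow>
      (\<exists>c x. halts_with a u (Alg c) \<and> halts_with b u x \<and> halts_with c x v)"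
    unfolding halts_with_def by (blast intro: run.Apply elim: runE)
  show "halts_with (Cond a b c) u v \<longleftrightarrow>
      (\<exists>n. halts_with a u (Num n) \<and> (if n = 0 then halts_with c u v else halts_with b u v))"
    (is "?L \<longleftrightarrow> ?R")
  proof
    assume ?L
    then obtain t where "run (Cond a b c) u v t" by (auto simp: halts_with_def)
    then show ?R by cases (metis halts_with_def nat.distinct(1))+
  next
    assume ?R
    then obtain n where n: "halts_with a u (Num n)"
      and bc: "if n = 0 then halts_with c u v else halts_with b u v" by blast
    show ?L
    proof (cases n)
      case 0
      with n bc show ?thesis unfolding halts_with_def by (auto dest: run.Cond_false)
    next
      case (Suc k)
      with n bc show ?thesis unfolding halts_with_def by (auto dest: run.Cond_true)
    qed
  qed
qed

lemma halts_with_While: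
  "halts_with (While a b) u v \<longleftrightarrow>
    (\<exists>n. halts_with a u (Num n) \<and>
      (if n = 0 then v = u else \<exists>x. halts_with b u x \<and> halts_with (While a b) x v))"
  (is "?L \<longleftrightarrow> ?R")
proof
  assume ?L
  then obtain t where "run (While a b) u v t" by (auto simp: halts_with_def)
  then show ?R by cases (metis halts_with_def nat.distinct(1))+
next
  assume ?R
  then obtain n where n: "halts_with a u (Num n)"
    and b: "if n = 0 then v = u else \<exists>x. halts_with b u x \<and> halts_with (While a b) x v" by blast
  show ?L
  proof (cases n)
    case 0
    with n b show ?thesis unfolding halts_with_def by (auto dest: run.While_stop)
  next
    case (Suc k)
    then obtain x where "halts_with b u x" "halts_with (While a b) x v" using b by auto
    with n Suc show ?thesis unfolding halts_with_def by (blast intro: run.While_step)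
  qed
qed

primrec datum_size :: "datum \<Rightarrow> nat" and algorithm_size :: "algorithm \<Rightarrow> nat" where
  "datum_size (Num n) = Suc n"
| "datum_size (Lst xs) = Suc (sum_list (map datum_size xs))"
| "datum_size (Alg a) = Suc (algorithm_size a)"
| "algorithm_size (Quote d) = Suc (datum_size d)"
| "algorithm_size Ident = 1"
| "algorithm_size Successor = 1"
| "algorithm_size (Prepend a b) = Suc (algorithm_size a + algorithm_size b)"
| "algorithm_size Head = 1"
| "algorithm_size Tail = 1"
| "algorithm_size Kind = 1"
| "algorithm_size (Equal a b) = Suc (algorithm_size a + algorithm_size b)"
| "algorithm_size Syntax = 1"
| "algorithm_size Build = 1"
| "algorithm_size (Compose a b) = Suc (algorithm_size a + algorithm_size b)"
| "algorithm_size (Cond a b c) = Suc (algorithm_size a + algorithm_size b + algorithm_size c)"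
| "algorithm_size (While a b) = Suc (algorithm_size a + algorithm_size b)"
| "algorithm_size (Apply a b) = Suc (algorithm_size a + algorithm_size b)"

lemma datum_size_positive: "0 < datum_size d"
  by (cases d) auto

lemma list_size_greater: "sum_list (map datum_size xs) < datum_size (Lst xs)"
  by simp

lemma finite_bounded_size: "finite {d. datum_size d \<le> n} \<and> finite {a. algorithm_size a \<le> n}"
proof (induction n)
  case 0
  have "\<not> algorithm_size a \<le> 0" for a by (cases a) auto
  moreover have "\<not> datum_size d \<le> 0" for d by (cases d) auto
  ultimately show ?case by (simp only: Collect_empty_eq finite.emptyI empty_def[symmetric] simp_thms)
next
  case (Suc n)
  let ?D = "{d. datum_size d \<le> n}" and ?A = "{a. algorithm_size a \<le> n}"
  have "length xs \<le> sum_list (map datum_size xs)" for xs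
  proof (induction xs)
    case (Cons d xs)
    then show ?case using datum_size_positive[of d] by simp
  qed simp
  then have len: "length xs \<le> n" if "sum_list (map datum_size xs) \<le> n" for xs
    using that order_trans by blast
  have mem: "datum_size d \<le> n" if "d \<in> set xs" "sum_list (map datum_size xs) \<le> n" for d xs
    using that member_le_sum_list[of "datum_size d" "map datum_size xs"] by auto
  have "{d. datum_size d \<le> Suc n} \<subseteq>
      Num ` {..n} \<union> Lst ` {xs. set xs \<subseteq> ?D \<and> length xs \<le> n} \<union> Alg ` ?A" (is "_ \<subseteq> ?X")
  proof
    fix d assume "d \<in> {d. datum_size d \<le> Suc n}"
    then show "d \<in> ?X" using len mem by (cases d) auto
  qed
  then have D: "finite {d. datum_size d \<le> Suc n}"
    using Suc.IH by (auto intro: finite_subset simp: finite_lists_length_le)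
  have "{a. algorithm_size a \<le> Suc n} \<subseteq> Quote ` ?D \<union>
      {Ident, Successor, Head, Tail, Kind, Syntax, Build} \<union>
      (\<lambda>(a, b). Prepend a b) ` (?A \<times> ?A) \<union> (\<lambda>(a, b). Equal a b) ` (?A \<times> ?A) \<union>
      (\<lambda>(a, b). Compose a b) ` (?A \<times> ?A) \<union> (\<lambda>(a, b, c). Cond a b c) ` (?A \<times> ?A \<times> ?A) \<union>
      (\<lambda>(a, b). While a b) ` (?A \<times> ?A) \<union> (\<lambda>(a, b). Apply a b) ` (?A \<times> ?A)" (is "_ \<subseteq> ?Y")
  proof
    fix a assume "a \<in> {a. algorithm_size a \<le> Suc n}"
    then show "a \<in> ?Y" by (cases a) (auto simp: image_iff)
  qed
  moreover have "finite ?Y" using Suc.IH by auto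
  ultimately show ?case using D finite_subset by blast
qed

section \<open>Algorithmic statements\<close>

definition is_statement :: "datum \<Rightarrow> bool" where
  "is_statement S \<longleftrightarrow> (\<exists>a u v. S = Lst [Alg a, u, v])"

definition holds :: "datum \<Rightarrow> bool" where
  "holds S \<longleftrightarrow> (\<exists>a u v. S = Lst [Alg a, u, v] \<and> halts_with a u v)"

section \<open>Rules and libraries\<close>

definition algorithmic_sequence :: "algorithm \<Rightarrow> bool" where
  "algorithmic_sequence \<rho> \<longleftrightarrow> (\<forall>n>0. \<exists>v. halts_with \<rho> (Num n) v)"

definition rule_input :: "datum list \<Rightarrow> algorithm \<Rightarrow> nat \<Rightarrow> datum" where
  "rule_input H \<rho> m = Lst [Lst H, Alg \<rho>, Num m]"

definition admissible_input :: "datum list \<Rightarrow> algorithm \<Rightarrow> nat \<Rightarrow> bool" where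
  "admissible_input H \<rho> m \<longleftrightarrow> (\<forall>S \<in> set H. is_statement S) \<and> algorithmic_sequence \<rho> \<and> 0 < m"

definition conclusions :: "algorithm \<Rightarrow> datum list \<Rightarrow> algorithm \<Rightarrow> nat \<Rightarrow> datum list" where
  "conclusions r H \<rho> m = (THE C. halts_with r (rule_input H \<rho> m) (Lst C))"

definition rule :: "algorithm \<Rightarrow> bool" where
  "rule r \<longleftrightarrow>
    (\<forall>H \<rho> m. admissible_input H \<rho> m \<longrightarrow>
      (\<exists>C. halts_with r (rule_input H \<rho> m) (Lst (H @ C)) \<and> (\<forall>S \<in> set C. is_statement S))) \<and>
    (\<forall>H H' \<rho> m m'. admissible_input H \<rho> m \<and> admissible_input H' \<rho> m' \<and> set H \<subseteq> set H' \<and> m \<le> m' \<longrightarrow>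
      set (conclusions r H \<rho> m) \<subseteq> set (conclusions r H' \<rho> m'))"

definition library :: "algorithm \<Rightarrow> bool" where
  "library \<rho> \<longleftrightarrow> algorithmic_sequence \<rho> \<and> (\<forall>n>0. \<exists>r. halts_with \<rho> (Num n) (Alg r) \<and> rule r)"

definition nth_rule :: "algorithm \<Rightarrow> nat \<Rightarrow> algorithm" where
  "nth_rule \<rho> n = (THE r. halts_with \<rho> (Num n) (Alg r))"

definition rules_of :: "algorithm \<Rightarrow> algorithm set" where
  "rules_of \<rho> = nth_rule \<rho> ` {n. 0 < n}"

definition valid_rule :: "algorithm \<Rightarrow> algorithm \<Rightarrow> bool" where
  "valid_rule \<rho> r \<longleftrightarrow>
    (\<forall>H m. (\<forall>S \<in> set H. holds S) \<and> 0 < m \<longrightarrow> (\<forall>S \<in> set (conclusions r H \<rho> m). holds S))"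

definition valid_library :: "algorithm \<Rightarrow> bool" where
  "valid_library \<rho> \<longleftrightarrow> library \<rho> \<and> (\<forall>r \<in> rules_of \<rho>. valid_rule \<rho> r)"

section \<open>Bases\<close>

definition base :: "algorithm set \<Rightarrow> bool" where
  "base \<B> \<longleftrightarrow> (\<forall>r \<in> \<B>. rule r) \<and> (finite \<B> \<or> (\<exists>\<rho>. library \<rho> \<and> \<B> = rules_of \<rho>))"

definition library_over :: "algorithm set \<Rightarrow> algorithm \<Rightarrow> bool" where
  "library_over \<B> \<rho> \<longleftrightarrow> library \<rho> \<and> \<B> \<subseteq> rules_of \<rho>"

definition valid_outside :: "algorithm set \<Rightarrow> algorithm \<Rightarrow> bool" where
  "valid_outside \<B> \<rho> \<longleftrightarrow> (\<forall>r \<in> rules_of \<rho> - \<B>. valid_rule \<rho> r)"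

definition stable_base :: "algorithm set \<Rightarrow> bool" where
  "stable_base \<B> \<longleftrightarrow> base \<B> \<and>
    (\<forall>\<rho>. library_over \<B> \<rho> \<and> valid_outside \<B> \<rho> \<longrightarrow> valid_library \<rho>)"

section \<open>Deduction\<close>

definition recursive_bijection :: "(nat \<Rightarrow> nat \<times> nat) \<Rightarrow> bool" where
  "recursive_bijection f \<longleftrightarrow>
    bij_betw f {n. 0 < n} ({n. 0 < n} \<times> {n. 0 < n}) \<and>
    (\<exists>a. \<forall>i>0. halts_with a (Num i) (Lst [Num (fst (f i)), Num (snd (f i))]))"

primrec deduction_list :: "(nat \<Rightarrow> nat \<times> nat) \<Rightarrow> datum list \<Rightarrow> algorithm \<Rightarrow> nat \<Rightarrow> datum list" where
  "deduction_list f \<Gamma> \<rho> 0 = \<Gamma>"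
| "deduction_list f \<Gamma> \<rho> (Suc i) =
    (case f (Suc i) of (k, m) \<Rightarrow> conclusions (nth_rule \<rho> k) (deduction_list f \<Gamma> \<rho> i) \<rho> m)"

text \<open>
  \<open>deduce\<close> enters only through its input-output behaviour on the inputs for which it is described,
  so it is a parameter ranging over all algorithms with that behaviour.
\<close>

definition implements_deduce :: "(nat \<Rightarrow> nat \<times> nat) \<Rightarrow> algorithm \<Rightarrow> bool" where
  "implements_deduce f deduce \<longleftrightarrow>
    (\<forall>\<Gamma> \<rho> B. (\<forall>S \<in> set \<Gamma>. is_statement S) \<and> library \<rho> \<and> is_statement B \<longrightarrow>
      (if \<exists>i>0. B \<in> set (deduction_list f \<Gamma> \<rho> i)
       then halts_with deduce (Lst [Lst \<Gamma>, Alg \<rho>, B]) (Num 1)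
       else \<nexists>v. halts_with deduce (Lst [Lst \<Gamma>, Alg \<rho>, B]) v))"

text \<open>
  The statements \<open>\<Gamma> \<turnstile>\<^sub>\<rho> B\<close> (\<open>entails\<close>) and \<open>A \<Rightarrow>\<^sub>\<rho> B\<close> (\<open>yields\<close>), for an arbitrary datum \<open>\<rho>\<close>.
\<close>

definition entails :: "algorithm \<Rightarrow> datum list \<Rightarrow> datum \<Rightarrow> datum \<Rightarrow> datum" where
  "entails deduce \<Gamma> \<rho> B = Lst [Alg deduce, Lst [Lst \<Gamma>, \<rho>, B], Num 1]"

definition yields :: "algorithm \<Rightarrow> datum \<Rightarrow> datum \<Rightarrow> datum \<Rightarrow> datum" where
  "yields deduce A \<rho> B = entails deduce [A] \<rho> B"

text \<open>
  The diagram \<open>A \<Rightarrow>\<^sub>\<rho> B, A / B\<close>. The diagram does not fix order and multiplicity of the appended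
  conclusions, so these are left free.
\<close>

definition implements_P3 :: "algorithm \<Rightarrow> algorithm \<Rightarrow> bool" where
  "implements_P3 deduce r \<longleftrightarrow>
    (\<forall>H \<rho> m. admissible_input H \<rho> m \<longrightarrow>
      (\<exists>C. halts_with r (rule_input H \<rho> m) (Lst (H @ C)) \<and>
        set C = {B. is_statement B \<and>
          (\<exists>A. is_statement A \<and> yields deduce A (Alg \<rho>) B \<in> set H \<and> A \<in> set H)}))"

section \<open>Existence of a deduction algorithm\<close>

text \<open>The hypothesis \<open>implements_deduce f deduce\<close> is satisfiable for every recursive bijection \<open>f\<close>.\<close>

definition "item1 = Head"
definition "item2 = Compose Head Tail"
definition "item3 = Compose Head (Compose Tail Tail)"
definition "item4 = Compose Head (Compose Tail (Compose Tail Tail))"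

lemmas items = item1_def item2_def item3_def item4_def

definition member :: algorithm where
  "member =
    Cond (Equal (Compose item2 (While
        (Cond (Equal item2 (Quote (Lst []))) (Quote (Num 0))
          (Cond (Equal item1 (Compose Head item2)) (Quote (Num 0)) (Quote (Num 1))))
        (Prepend item1 (Prepend (Compose Tail item2) (Quote (Lst []))))))
      (Quote (Lst []))) (Quote (Num 0)) (Quote (Num 1))"

lemma halts_with_member:
  "halts_with member (Lst [x, Lst xs]) v \<longleftrightarrow> v = Num (if x \<in> set xs then 1 else 0)"
proof -
  let ?c = "Cond (Equal item2 (Quote (Lst []))) (Quote (Num 0))
          (Cond (Equal item1 (Compose Head item2)) (Quote (Num 0)) (Quote (Num 1)))"
  let ?b = "Prepend item1 (Prepend (Compose Tail item2) (Quote (Lst [])))"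
  have "halts_with (While ?c ?b) (Lst [x, Lst xs]) w \<longleftrightarrow> w = Lst [x, Lst (dropWhile (\<lambda>y. y \<noteq> x) xs)]" for w
  proof (induction xs)
    case Nil
    show ?case by (subst halts_with_While) (simp add: items)
  next
    case (Cons y ys)
    then show ?case by (subst halts_with_While) (simp add: items)
  qed
  then show ?thesis
    unfolding member_def by (simp add: items dropWhile_eq_Nil_conv) blast
qed

lemma nth_rule_eq: "halts_with \<rho> (Num n) (Alg r) \<Longrightarrow> nth_rule \<rho> n = r"
  unfolding nth_rule_def using halts_with_unique by blast

lemma halts_with_nth_rule: "library \<rho> \<Longrightarrow> 0 < n \<Longrightarrow> halts_with \<rho> (Num n) (Alg (nth_rule \<rho> n)) \<and> rule (nth_rule \<rho> n)"
  unfolding library_def using nth_rule_eq by blast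

lemma conclusions_eq: "halts_with r (rule_input H \<rho> m) (Lst C) \<Longrightarrow> conclusions r H \<rho> m = C"
  unfolding conclusions_def using halts_with_unique by blast

lemma halts_with_conclusions:
  assumes "rule r" "admissible_input H \<rho> m"
  shows "halts_with r (rule_input H \<rho> m) (Lst (conclusions r H \<rho> m)) \<and>
    set H \<subseteq> set (conclusions r H \<rho> m) \<and> (\<forall>S \<in> set (conclusions r H \<rho> m). is_statement S)"
proof -
  obtain C where "halts_with r (rule_input H \<rho> m) (Lst (H @ C))" "\<forall>S \<in> set C. is_statement S"
    using assms unfolding rule_def by blast
  then show ?thesis using assms conclusions_eq unfolding admissible_input_def by fastforce
qed

lemma recursive_bijection_pos:
  assumes "recursive_bijection f"
  shows "0 < fst (f (Suc i))" and "0 < snd (f (Suc i))"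
  using assms bij_betwE[of f "{n. 0 < n}" "{n. 0 < n} \<times> {n. 0 < n}"]
  unfolding recursive_bijection_def by (auto simp: mem_Times_iff)

lemma deduction_list_step:
  assumes f: "recursive_bijection f" and \<rho>: "library \<rho>" and \<Gamma>: "\<forall>S \<in> set \<Gamma>. is_statement S"
  shows "admissible_input (deduction_list f \<Gamma> \<rho> i) \<rho> 1 \<and>
    halts_with (nth_rule \<rho> (fst (f (Suc i))))
      (rule_input (deduction_list f \<Gamma> \<rho> i) \<rho> (snd (f (Suc i))))
      (Lst (deduction_list f \<Gamma> \<rho> (Suc i))) \<and>
    set (deduction_list f \<Gamma> \<rho> i) \<subseteq> set (deduction_list f \<Gamma> \<rho> (Suc i))"
proof (induction i)
  note pos = recursive_bijection_pos[OF f]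
  have step: "halts_with (nth_rule \<rho> (fst (f (Suc i))))
      (rule_input (deduction_list f \<Gamma> \<rho> i) \<rho> (snd (f (Suc i))))
      (Lst (deduction_list f \<Gamma> \<rho> (Suc i))) \<and>
      set (deduction_list f \<Gamma> \<rho> i) \<subseteq> set (deduction_list f \<Gamma> \<rho> (Suc i)) \<and>
      admissible_input (deduction_list f \<Gamma> \<rho> (Suc i)) \<rho> 1"
    if "admissible_input (deduction_list f \<Gamma> \<rho> i) \<rho> 1" for i
    using halts_with_conclusions[of "nth_rule \<rho> (fst (f (Suc i)))" "deduction_list f \<Gamma> \<rho> i" \<rho> "snd (f (Suc i))"]
      halts_with_nth_rule[OF \<rho> pos(1)] pos(2) that
    by (auto simp: admissible_input_def case_prod_beta)
  {
    case 0
    then show ?case using step[of 0] \<Gamma> \<rho> by (auto simp: admissible_input_def library_def)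
  next
    case (Suc i)
    then show ?case using step by blast
  }
qed

lemma deduce_exists:
  assumes f: "recursive_bijection f"
  shows "\<exists>deduce. implements_deduce f deduce"
proof -
  obtain e where e: "\<And>i. 0 < i \<Longrightarrow> halts_with e (Num i) (Lst [Num (fst (f i)), Num (snd (f i))])"
    using f unfolding recursive_bijection_def by blast
  define test where "test = Cond (Compose member (Prepend item4 (Prepend item2 (Quote (Lst [])))))
    (Quote (Num 0)) (Quote (Num 1))"
  define code where "code = Compose e (Compose Successor item1)"
  define advance where "advance = Apply (Apply item3 (Compose item1 code))
    (Prepend item2 (Prepend item3 (Prepend (Compose item2 code) (Quote (Lst [])))))"
  define body where "body = Prepend (Compose Successor item1) (Prepend advance
    (Prepend item3 (Prepend item4 (Quote (Lst [])))))"
  define deduce where "deduce = Compose (Quote (Num 1))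
    (Compose (While test body) (Prepend (Quote (Num 0)) Ident))"
  have "implements_deduce f deduce"
    unfolding implements_deduce_def
  proof (intro allI impI, elim conjE)
    fix \<Gamma> \<rho> B
    assume \<Gamma>: "\<forall>S \<in> set \<Gamma>. is_statement S" and \<rho>: "library \<rho>"
    let ?H = "deduction_list f \<Gamma> \<rho>"
    let ?s = "\<lambda>i. Lst [Num i, Lst (?H i), Alg \<rho>, B]"
    note step = deduction_list_step[OF f \<rho> \<Gamma>]
    have test: "halts_with test (?s i) (Num n) \<longleftrightarrow> n = (if B \<in> set (?H i) then 0 else 1)" for i n
      by (auto simp: test_def items halts_with_member)
    have body_next: "halts_with body (?s i) (?s (Suc i))" for i
    proof -
      let ?k = "fst (f (Suc i))" and ?m = "snd (f (Suc i))"
      have "halts_with code (?s i) (Lst [Num ?k, Num ?m])"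
        using e[of "Suc i"] by (simp add: code_def items)
      moreover have "halts_with \<rho> (Num ?k) (Alg (nth_rule \<rho> ?k))"
        using halts_with_nth_rule[OF \<rho>] recursive_bijection_pos[OF f] by blast
      ultimately have "halts_with (Apply item3 (Compose item1 code)) (?s i) (Alg (nth_rule \<rho> ?k))"
        and "halts_with (Prepend item2 (Prepend item3 (Prepend (Compose item2 code) (Quote (Lst [])))))
          (?s i) (rule_input (?H i) \<rho> ?m)"
        by (auto simp: items rule_input_def)
      then have "halts_with advance (?s i) (Lst (?H (Suc i)))"
        using step[of i] unfolding advance_def halts_with_simps(11) by blast
      then show ?thesis by (simp add: body_def items del: deduction_list.simps)
    qed
    have body: "halts_with body (?s i) v \<longleftrightarrow> v = ?s (Suc i)" for i v
      using body_next[of i] by (metis halts_with_unique)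
    have stop: "\<exists>v. halts_with (While test body) (?s i) v" if "B \<in> set (?H j)" "i \<le> j" for i j
      using that(2)
    proof (induction rule: inc_induct)
      case base
      then show ?case using that by (subst halts_with_While) (simp add: test)
    next
      case (step i)
      then show ?case by (subst halts_with_While) (auto simp: test body simp del: deduction_list.simps)
    qed
    have found: "\<exists>j. B \<in> set (?H j)" if "run (While test body) (?s i) v t" for i v t
      using that
    proof (induction "While test body" "?s i" v t arbitrary: i rule: run.induct)
      case (While_stop t i)
      then have "halts_with test (?s i) (Num 0)" unfolding halts_with_def by blast
      then show ?case unfolding test by (auto split: if_splits)
    next
      case (While_step n s x t v r i)
      then have "x = ?s (Suc i)" using body halts_with_def by blast
      then show ?case using While_step by blast
    qed
    have start: "halts_with deduce (Lst [Lst \<Gamma>, Alg \<rho>, B]) v \<longleftrightarrow>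
        v = Num 1 \<and> (\<exists>w. halts_with (While test body) (?s 0) w)" for v
      by (auto simp: deduce_def)
    have "set (?H 0) \<subseteq> set (?H 1)" using step[of 0] by simp
    then have later: "\<exists>i>0. B \<in> set (?H i)" if "B \<in> set (?H j)" for j
      using that by (cases j) (auto simp del: deduction_list.simps(2))
    show "if \<exists>i>0. B \<in> set (?H i) then halts_with deduce (Lst [Lst \<Gamma>, Alg \<rho>, B]) (Num 1)
       else \<nexists>v. halts_with deduce (Lst [Lst \<Gamma>, Alg \<rho>, B]) v"
    proof (cases "\<exists>i>0. B \<in> set (?H i)")
      case True
      then obtain j where "B \<in> set (?H j)" by blast
      then have "halts_with deduce (Lst [Lst \<Gamma>, Alg \<rho>, B]) (Num 1)"
        using stop[of j 0] start by blast
      with True show ?thesis by simp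
    next
      case False
      then have "\<nexists>w. halts_with (While test body) (?s 0) w"
        using found later unfolding halts_with_def by blast
      with False start show ?thesis by simp
    qed
  qed
  then show ?thesis ..
qed

end

(* Curry's paradox. Let F be a false statement. For every library \<rho> there is an algorithmic
   statement C, computable from \<rho>, which is true if and only if C \<Rightarrow>\<^sub>\<rho> F is; so the rule
   "C / C \<Rightarrow>\<^sub>\<rho> F" is valid. Let \<rho> enumerate a stable base together with this rule; then \<rho> is valid.
   From C the library deduces C \<Rightarrow>\<^sub>\<rho> F, hence F by the law. Thus C \<Rightarrow>\<^sub>\<rho> F is true, so C is true,
   and the valid library \<rho> deduces the false statement F from it. *)

theory Submission
  imports Defs
begin

section \<open>Deduction\<close>

lemma conclusions_mono:
  assumes "rule r" "admissible_input H \<rho> m" "admissible_input H' \<rho> m'" "set H \<subseteq> set H'" "m \<le> m'"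
  shows "set (conclusions r H \<rho> m) \<subseteq> set (conclusions r H' \<rho> m')"
  using assms unfolding rule_def by blast

lemma admissible_deduction_list:
  assumes "recursive_bijection f" "library \<rho>" "\<forall>S \<in> set \<Gamma>. is_statement S" "0 < m"
  shows "admissible_input (deduction_list f \<Gamma> \<rho> i) \<rho> m"
  using deduction_list_step[OF assms(1-3), of i] assms(4) by (simp add: admissible_input_def)

lemma deduction_list_mono:
  assumes "recursive_bijection f" "library \<rho>" "\<forall>S \<in> set \<Gamma>. is_statement S" "i \<le> j"
  shows "set (deduction_list f \<Gamma> \<rho> i) \<subseteq> set (deduction_list f \<Gamma> \<rho> j)"
  using lift_Suc_mono_le[of "\<lambda>i. set (deduction_list f \<Gamma> \<rho> i)" i j]
    deduction_list_step[OF assms(1-3)] assms(4) by blast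

text \<open>As \<open>f\<close> is onto, all the infinitely many pairs (k, m') with m' \<ge> m are
  values of \<open>f\<close>, and only finitely many of them are taken at arguments up to
  \<open>i\<close>. This is the fairness of the deduction schedule.\<close>

lemma ex_later_step:
  assumes f: "recursive_bijection f" and "0 < k" "0 < m"
  shows "\<exists>j\<ge>i. \<exists>m'\<ge>m. f (Suc j) = (k, m')"
proof (rule ccontr)
  assume early: "\<not> ?thesis"
  have bij: "bij_betw f {n. 0 < n} ({n. 0 < n} \<times> {n. 0 < n})"
    using f unfolding recursive_bijection_def by blast
  have "{k} \<times> {m..} \<subseteq> f ` {..i}"
  proof
    fix p assume p: "p \<in> {k} \<times> {m..}"
    then have "p \<in> f ` {n. 0 < n}"
      using assms(2,3) bij_betw_imp_surj_on[OF bij] by auto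
    then obtain j where j: "p = f (Suc j)" by (metis imageE mem_Collect_eq gr0_implies_Suc)
    then have "\<not> i \<le> j" using early p by force
    with j show "p \<in> f ` {..i}" by auto
  qed
  then have "finite ({k} \<times> {m..})" using finite_surj by blast
  then show False using finite_cartesian_productD2 infinite_Ici by blast
qed

text \<open>By fairness \<open>r\<close> is applied at a later stage, to a larger list and with a
  larger resource; monotonicity of rules does the rest.\<close>

lemma ex_deduction_list_conclusions:
  assumes f: "recursive_bijection f" and \<rho>: "library \<rho>" and \<Gamma>: "\<forall>S \<in> set \<Gamma>. is_statement S"
    and r: "r \<in> rules_of \<rho>" and H: "admissible_input H \<rho> m"
    and sub: "set H \<subseteq> set (deduction_list f \<Gamma> \<rho> i)"
  shows "\<exists>j>0. set (conclusions r H \<rho> m) \<subseteq> set (deduction_list f \<Gamma> \<rho> j)"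
proof -
  obtain k where k: "0 < k" "nth_rule \<rho> k = r" using r unfolding rules_of_def by blast
  have m: "0 < m" using H by (simp add: admissible_input_def)
  obtain j m' where j: "i \<le> j" "m \<le> m'" "f (Suc j) = (k, m')"
    using ex_later_step[OF f k(1) m] by blast
  have "set (conclusions r H \<rho> m) \<subseteq> set (conclusions r (deduction_list f \<Gamma> \<rho> j) \<rho> m')"
  proof (rule conclusions_mono)
    show "rule r" using halts_with_nth_rule[OF \<rho> k(1)] k(2) by simp
    show "admissible_input (deduction_list f \<Gamma> \<rho> j) \<rho> m'"
      using admissible_deduction_list[OF f \<rho> \<Gamma>] m j(2) by simp
    show "set H \<subseteq> set (deduction_list f \<Gamma> \<rho> j)"
      using sub deduction_list_mono[OF f \<rho> \<Gamma> j(1)] by blast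
  qed (use H j in auto)
  then have "set (conclusions r H \<rho> m) \<subseteq> set (deduction_list f \<Gamma> \<rho> (Suc j))"
    using j(3) k(2) by simp
  then show ?thesis by blast
qed

text \<open>A deduction from \<Delta> is replayed inside the one from \<Gamma>, each of its rule
  applications being absorbed by \<open>ex_deduction_list_conclusions\<close>.\<close>

lemma deduction_list_cut:
  assumes f: "recursive_bijection f" and \<rho>: "library \<rho>"
    and \<Gamma>: "\<forall>S \<in> set \<Gamma>. is_statement S" and \<Delta>: "\<forall>S \<in> set \<Delta>. is_statement S"
    and sub: "set \<Delta> \<subseteq> set (deduction_list f \<Gamma> \<rho> i)"
  shows "\<exists>l>0. set (deduction_list f \<Delta> \<rho> j) \<subseteq> set (deduction_list f \<Gamma> \<rho> l)"
proof (induction j)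
  case 0
  \<comment> \<open>The index moves to \<open>Suc i\<close> because \<open>i\<close> may be 0, while
    \<open>l\<close> must be positive.\<close>
  have "set \<Delta> \<subseteq> set (deduction_list f \<Gamma> \<rho> (Suc i))"
    using sub deduction_list_mono[OF f \<rho> \<Gamma>, of i "Suc i"] by (simp del: deduction_list.simps)
  then show ?case by (auto simp del: deduction_list.simps(2))
next
  case (Suc j)
  then obtain l where l: "set (deduction_list f \<Delta> \<rho> j) \<subseteq> set (deduction_list f \<Gamma> \<rho> l)" by blast
  obtain k m where km: "f (Suc j) = (k, m)" "0 < k" "0 < m"
    using recursive_bijection_pos[OF f, of j] by (metis prod.collapse)
  have "nth_rule \<rho> k \<in> rules_of \<rho>" using km by (simp add: rules_of_def)
  from ex_deduction_list_conclusions[OF f \<rho> \<Gamma> this _ l]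
    admissible_deduction_list[OF f \<rho> \<Delta>, of m j] km
  show ?case by simp
qed

lemma deduction_list_holds:
  assumes f: "recursive_bijection f" and \<rho>: "valid_library \<rho>" and \<Gamma>: "\<forall>S \<in> set \<Gamma>. holds S"
  shows "\<forall>S \<in> set (deduction_list f \<Gamma> \<rho> i). holds S"
proof (induction i)
  case (Suc i)
  obtain k m where km: "f (Suc i) = (k, m)" "0 < k" "0 < m"
    using recursive_bijection_pos[OF f, of i] by (metis prod.collapse)
  have "nth_rule \<rho> k \<in> rules_of \<rho>" using km(2) by (simp add: rules_of_def)
  then have "valid_rule \<rho> (nth_rule \<rho> k)" using \<rho> by (simp add: valid_library_def)
  then have "\<forall>S \<in> set (conclusions (nth_rule \<rho> k) (deduction_list f \<Gamma> \<rho> i) \<rho> m). holds S"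
    using Suc km(3) unfolding valid_rule_def by blast
  then show ?case by (simp add: km(1))
qed (use \<Gamma> in simp)

lemma is_statement_entails [simp]: "is_statement (entails deduce \<Gamma> \<rho> B)"
  by (simp add: entails_def is_statement_def)

text \<open>The index is positive because \<open>deduce\<close> tests only the computed lists, not
  the initial list \<Gamma>.\<close>

lemma holds_entails:
  assumes d: "implements_deduce f deduce" and "library \<rho>"
    and "\<forall>S \<in> set \<Gamma>. is_statement S" "is_statement B"
  shows "holds (entails deduce \<Gamma> (Alg \<rho>) B) \<longleftrightarrow> (\<exists>i>0. B \<in> set (deduction_list f \<Gamma> \<rho> i))"
proof -
  have "if \<exists>i>0. B \<in> set (deduction_list f \<Gamma> \<rho> i)
       then halts_with deduce (Lst [Lst \<Gamma>, Alg \<rho>, B]) (Num 1)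
       else \<nexists>v. halts_with deduce (Lst [Lst \<Gamma>, Alg \<rho>, B]) v"
    using assms unfolding implements_deduce_def by blast
  then show ?thesis by (auto simp: holds_def entails_def split: if_splits)
qed

text \<open>This derives the law from the presence of \<open>P3\<close> in the library: a single
  application of \<open>P3\<close> to the two premises suffices.\<close>

lemma entails_modus_ponens:
  assumes f: "recursive_bijection f" and d: "implements_deduce f deduce"
    and P3: "implements_P3 deduce P3" and \<rho>: "library \<rho>" "P3 \<in> rules_of \<rho>"
    and AB: "is_statement A" "is_statement B"
  shows "holds (entails deduce [yields deduce A (Alg \<rho>) B, A] (Alg \<rho>) B)"
proof -
  let ?H = "[yields deduce A (Alg \<rho>) B, A]"
  have H: "admissible_input ?H \<rho> 1"
    using AB \<rho> by (simp add: admissible_input_def library_def yields_def)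
  then obtain C where C: "halts_with P3 (rule_input ?H \<rho> 1) (Lst (?H @ C))"
    "set C = {B. is_statement B \<and> (\<exists>A. is_statement A \<and> yields deduce A (Alg \<rho>) B \<in> set ?H \<and> A \<in> set ?H)}"
    using P3 unfolding implements_P3_def by blast
  have "B \<in> set C" unfolding C(2) using AB by auto
  then have "B \<in> set (conclusions P3 ?H \<rho> 1)" using conclusions_eq[OF C(1)] by simp
  moreover have \<Gamma>: "\<forall>S \<in> set ?H. is_statement S" using H unfolding admissible_input_def by blast
  moreover have "set ?H \<subseteq> set (deduction_list f ?H \<rho> 0)" by simp
  ultimately show ?thesis
    using ex_deduction_list_conclusions[OF f \<rho>(1) \<Gamma> \<rho>(2) H] holds_entails[OF d \<rho>(1) \<Gamma> AB(2)]
    by blast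
qed

section \<open>Adding a rule to a base\<close>

lemma library_insert:
  assumes f: "recursive_bijection f" and \<sigma>: "library \<sigma>" and r: "rule r"
  shows "\<exists>\<rho>. library \<rho> \<and> rules_of \<rho> = insert r (rules_of \<sigma>)"
proof -
  obtain e where e: "\<And>i. 0 < i \<Longrightarrow> halts_with e (Num i) (Lst [Num (fst (f i)), Num (snd (f i))])"
    and bij: "bij_betw f {n. 0 < n} ({n. 0 < n} \<times> {n. 0 < n})"
    using f unfolding recursive_bijection_def by blast
  then have e_iff: "halts_with e (Num i) v \<longleftrightarrow> v = Lst [Num (fst (f i)), Num (snd (f i))]"
    if "0 < i" for i v
    using that halts_with_unique by blast
  \<comment> \<open>The position \<open>i\<close> is decoded into a pair by \<open>e\<close>: second
    component 1 selects \<open>r\<close>, any other value selects the rule of \<sigma> at the first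
    component. This avoids programming a predecessor for the shifted sequence.\<close>
  let ?\<rho> = "Cond (Equal (Compose item2 e) (Quote (Num 1))) (Quote (Alg r)) (Compose \<sigma> (Compose item1 e))"
  let ?r = "\<lambda>i. if snd (f i) = 1 then r else nth_rule \<sigma> (fst (f i))"
  have halts: "halts_with ?\<rho> (Num i) (Alg (?r i)) \<and> rule (?r i)" if i: "0 < i" for i
  proof -
    have "0 < fst (f i)" using recursive_bijection_pos(1)[OF f, of "i - 1"] i by simp
    from halts_with_nth_rule[OF \<sigma> this]
    have \<sigma>': "halts_with \<sigma> (Num (fst (f i))) (Alg (nth_rule \<sigma> (fst (f i))))"
      and "rule (nth_rule \<sigma> (fst (f i)))" by auto
    moreover have "halts_with ?\<rho> (Num i) (Alg (?r i))"
      using \<sigma>' by (simp add: items e_iff[OF i])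
    ultimately show ?thesis using r by simp
  qed
  have "nth_rule ?\<rho> i = ?r i" if "0 < i" for i
    using halts[OF that] nth_rule_eq by blast
  then have "rules_of ?\<rho> = ?r ` {n. 0 < n}" unfolding rules_of_def by (intro image_cong) simp_all
  also have "\<dots> = (\<lambda>(k, m::nat). if m = 1 then r else nth_rule \<sigma> k) ` f ` {n. 0 < n}"
    by (simp only: image_image case_prod_beta)
  also have "\<dots> = (\<lambda>(k, m::nat). if m = 1 then r else nth_rule \<sigma> k) ` ({n. 0 < n} \<times> {n. 0 < n})"
    by (simp only: bij_betw_imp_surj_on[OF bij])
  also have "\<dots> = insert r (rules_of \<sigma>)" (is "?L = ?R")
  proof
    show "?L \<subseteq> ?R" by (auto simp: rules_of_def)
    have "r \<in> ?L" by (rule image_eqI[of _ _ "(1, 1)"]) simp_all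
    moreover have "nth_rule \<sigma> k \<in> ?L" if "0 < k" for k
      by (rule image_eqI[of _ _ "(k, 2)"]) (simp_all add: that)
    ultimately show "?R \<subseteq> ?L" unfolding rules_of_def by blast
  qed
  finally have "rules_of ?\<rho> = insert r (rules_of \<sigma>)" .
  moreover have "library ?\<rho>"
    using halts unfolding library_def algorithmic_sequence_def by blast
  ultimately show ?thesis by blast
qed

text \<open>A finite base is reached from the constant library with value \<open>r\<close> by
  inserting its rules one at a time.\<close>

lemma base_insert:
  assumes f: "recursive_bijection f" and \<B>: "base \<B>" and r: "rule r"
  shows "\<exists>\<rho>. library \<rho> \<and> rules_of \<rho> = insert r \<B>"
proof -
  have rules: "\<forall>s \<in> \<B>. rule s" and "finite \<B> \<or> (\<exists>\<sigma>. library \<sigma> \<and> \<B> = rules_of \<sigma>)"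
    using \<B> unfolding base_def by auto
  then consider "finite \<B>" | \<sigma> where "library \<sigma>" "\<B> = rules_of \<sigma>" by blast
  then show ?thesis
  proof cases
    case 1
    then show ?thesis using rules
    proof (induction \<B>)
      case empty
      have "nth_rule (Quote (Alg r)) n = r" for n by (rule nth_rule_eq) simp
      then have "rules_of (Quote (Alg r)) = {r}" unfolding rules_of_def by auto
      moreover have "library (Quote (Alg r))"
        using r by (simp add: library_def algorithmic_sequence_def)
      ultimately show ?case by blast
    next
      case (insert s \<B>)
      then obtain \<sigma> where "library \<sigma>" "rules_of \<sigma> = insert r \<B>" by auto
      with library_insert[OF f, of \<sigma> s] insert.prems show ?case
        by (metis insertI1 insert_commute)
    qed
  next
    case 2
    then show ?thesis using library_insert[OF f _ r] by blast
  qed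
qed

section \<open>The Curry rule\<close>

definition reverse_onto :: algorithm where
  "reverse_onto = While (Cond (Equal item2 (Quote (Lst []))) (Quote (Num 0)) (Quote (Num 1)))
    (Prepend (Prepend (Compose Head item2) item1) (Prepend (Compose Tail item2) (Quote (Lst []))))"

lemma halts_with_reverse_onto:
  "halts_with reverse_onto (Lst [Lst ys, Lst xs]) v \<longleftrightarrow> v = Lst [Lst (rev xs @ ys), Lst []]"
proof (induction xs arbitrary: ys)
  case Nil
  show ?case unfolding reverse_onto_def by (subst halts_with_While) (simp add: items)
next
  case (Cons x xs)
  from Cons.IH[unfolded reverse_onto_def] show ?case
    unfolding reverse_onto_def by (subst halts_with_While) (simp add: items)
qed

text \<open>The language extends lists only at the front, but a conclusion list must begin with the
  hypothesis list. So the list is reversed onto the empty list, and the result is reversed onto the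
  singleton of the new item.\<close>

definition append_item :: algorithm where
  "append_item = Compose item1 (Compose reverse_onto
    (Prepend (Prepend item1 (Quote (Lst [])))
      (Prepend (Compose item1 (Compose reverse_onto (Prepend (Quote (Lst [])) Tail))) (Quote (Lst [])))))"

lemma halts_with_append_item:
  "halts_with append_item (Lst [x, Lst xs]) v \<longleftrightarrow> v = Lst (xs @ [x])"
  by (auto simp: append_item_def items halts_with_reverse_onto)

text \<open>
  The self-reference: with input \<open>[\<alpha>, \<rho>]\<close> this algorithm behaves as \<open>deduce\<close> for
  \<open>[\<alpha>, [\<alpha>, \<rho>], 1] \<Rightarrow>\<^sub>\<rho> F\<close>. The statement \<open>curry_statement\<close> takes the algorithm itself for \<open>\<alpha>\<close>.
\<close>

definition curry_algorithm :: "algorithm \<Rightarrow> datum \<Rightarrow> algorithm" where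
  "curry_algorithm deduce F = Compose deduce
    (Prepend (Prepend (Prepend item1 (Prepend Ident (Quote (Lst [Num 1])))) (Quote (Lst [])))
      (Prepend item2 (Quote (Lst [F]))))"

definition curry_statement :: "algorithm \<Rightarrow> datum \<Rightarrow> datum \<Rightarrow> datum" where
  "curry_statement deduce F \<rho> =
    Lst [Alg (curry_algorithm deduce F), Lst [Alg (curry_algorithm deduce F), \<rho>], Num 1]"

lemma is_statement_curry_statement [simp]: "is_statement (curry_statement deduce F \<rho>)"
  by (simp add: curry_statement_def is_statement_def)

text \<open>When the algorithm is its own first input item, the hypothesis that it assembles for
  \<open>deduce\<close> is the Curry statement itself, so both sides describe the same computation
  of \<open>deduce\<close>.\<close>

lemma holds_curry_statement:
  "holds (curry_statement deduce F \<rho>) \<longleftrightarrow> holds (yields deduce (curry_statement deduce F \<rho>) \<rho> F)"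
proof -
  have "halts_with (curry_algorithm deduce F) (Lst [x, \<rho>]) v \<longleftrightarrow>
      halts_with deduce (Lst [Lst [Lst [x, Lst [x, \<rho>], Num 1]], \<rho>, F]) v" for x v
    by (simp add: curry_algorithm_def items)
  then show ?thesis
    by (simp add: holds_def yields_def entails_def curry_statement_def)
qed

text \<open>The library is read from the rule input by \<open>item2\<close> and is not built into
  the rule. Hence the Curry rule can be fixed before the library that will contain it, without
  circularity.\<close>

definition curry_premise :: "algorithm \<Rightarrow> datum \<Rightarrow> algorithm" where
  "curry_premise deduce F =
    (let c = Quote (Alg (curry_algorithm deduce F))
     in Prepend c (Prepend (Prepend c (Prepend item2 (Quote (Lst [])))) (Quote (Lst [Num 1]))))"

definition curry_conclusion :: "algorithm \<Rightarrow> datum \<Rightarrow> algorithm" where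
  "curry_conclusion deduce F = Prepend (Quote (Alg deduce))
    (Prepend (Prepend (Prepend (curry_premise deduce F) (Quote (Lst []))) (Prepend item2 (Quote (Lst [F]))))
      (Quote (Lst [Num 1])))"

definition curry_rule :: "algorithm \<Rightarrow> datum \<Rightarrow> algorithm" where
  "curry_rule deduce F =
    Cond (Compose member (Prepend (curry_premise deduce F) (Prepend item1 (Quote (Lst [])))))
      (Compose append_item (Prepend (curry_conclusion deduce F) (Prepend item1 (Quote (Lst [])))))
      item1"

lemma halts_with_curry_premise:
  "halts_with (curry_premise deduce F) (rule_input H \<rho> m) v \<longleftrightarrow> v = curry_statement deduce F (Alg \<rho>)"
  by (auto simp: curry_premise_def Let_def items rule_input_def curry_statement_def)

lemma halts_with_curry_conclusion:
  "halts_with (curry_conclusion deduce F) (rule_input H \<rho> m) v \<longleftrightarrow>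
    v = yields deduce (curry_statement deduce F (Alg \<rho>)) (Alg \<rho>) F"
  by (auto simp: curry_conclusion_def halts_with_curry_premise yields_def entails_def)
    (auto simp: items rule_input_def)

lemma halts_with_curry_rule:
  "halts_with (curry_rule deduce F) (rule_input H \<rho> m)
    (Lst (H @ (if curry_statement deduce F (Alg \<rho>) \<in> set H
       then [yields deduce (curry_statement deduce F (Alg \<rho>)) (Alg \<rho>) F] else [])))"
proof -
  have "halts_with item1 (rule_input H \<rho> m) v \<longleftrightarrow> v = Lst H" for v
    by (auto simp: items rule_input_def)
  then show ?thesis
    by (simp add: curry_rule_def halts_with_member halts_with_append_item
        halts_with_curry_premise halts_with_curry_conclusion)
qed

lemmas conclusions_curry_rule = conclusions_eq[OF halts_with_curry_rule]

lemma rule_curry_rule: "rule (curry_rule deduce F)"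
  unfolding rule_def
proof (intro conjI allI impI)
  fix H \<rho> m
  show "\<exists>C. halts_with (curry_rule deduce F) (rule_input H \<rho> m) (Lst (H @ C)) \<and>
      (\<forall>S \<in> set C. is_statement S)"
    by (intro exI conjI, rule halts_with_curry_rule) (simp add: yields_def)
qed (auto simp: conclusions_curry_rule)

text \<open>Validity is the forward direction of \<open>holds_curry_statement\<close>; the backward
  direction serves in the final contradiction.\<close>

lemma valid_rule_curry_rule: "valid_rule \<rho> (curry_rule deduce F)"
  unfolding valid_rule_def conclusions_curry_rule
  using holds_curry_statement[of deduce F "Alg \<rho>"] by auto

theorem no_stable_base_modus_ponens:
  assumes f: "recursive_bijection f" and d: "implements_deduce f deduce"
    and stable: "stable_base \<B>"
    and law: "\<And>\<rho> A B. library_over \<B> \<rho> \<Longrightarrow> is_statement A \<Longrightarrow> is_statement B \<Longrightarrow>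
      holds (entails deduce [yields deduce A (Alg \<rho>) B, A] (Alg \<rho>) B)"
  shows False
proof -
  \<comment> \<open>The identity maps 0 to 0, so this statement is false.\<close>
  define F where "F = Lst [Alg Ident, Num 0, Num 1]"
  have F: "is_statement F" "\<not> holds F" by (simp_all add: F_def is_statement_def holds_def)
  let ?R = "curry_rule deduce F"
  obtain \<rho> where \<rho>: "library \<rho>" "rules_of \<rho> = insert ?R \<B>"
    using base_insert[OF f _ rule_curry_rule] stable unfolding stable_base_def by blast
  then have over: "library_over \<B> \<rho>" by (auto simp: library_over_def)
  \<comment> \<open>Only \<open>?R\<close> can be a rule of \<rho> outside \<B>.\<close>
  moreover have "valid_outside \<B> \<rho>"
    using \<rho>(2) valid_rule_curry_rule by (auto simp: valid_outside_def)
  ultimately have valid: "valid_library \<rho>" using stable unfolding stable_base_def by blast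
  define C where "C = curry_statement deduce F (Alg \<rho>)"
  define D where "D = yields deduce C (Alg \<rho>) F"
  have C: "is_statement C" and D: "is_statement D" by (simp_all add: C_def D_def yields_def)
  let ?H = "deduction_list f [C] \<rho>"
  have \<Gamma>: "\<forall>S \<in> set [C]. is_statement S" "\<forall>S \<in> set [D, C]. is_statement S" using C D by simp_all
  have "admissible_input [C] \<rho> 1" using C \<rho>(1) by (simp add: admissible_input_def library_def)
  moreover have "set [C] \<subseteq> set (?H 0)" "?R \<in> rules_of \<rho>" using \<rho>(2) by simp_all
  ultimately obtain i where "set (conclusions ?R [C] \<rho> 1) \<subseteq> set (?H i)"
    using ex_deduction_list_conclusions[OF f \<rho>(1) \<Gamma>(1)] by blast
  moreover have "conclusions ?R [C] \<rho> 1 = [C, D]"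
    by (simp add: conclusions_curry_rule C_def[symmetric] D_def[symmetric])
  ultimately have i: "set [D, C] \<subseteq> set (?H i)" by (simp only: set_simps insert_commute)
  have "holds (entails deduce [D, C] (Alg \<rho>) F)" unfolding D_def using law[OF over C F(1)] .
  then obtain j where j: "F \<in> set (deduction_list f [D, C] \<rho> j)"
    using holds_entails[OF d \<rho>(1) \<Gamma>(2) F(1)] by blast
  \<comment> \<open>Since \<open>D\<close> and \<open>C\<close> both occur in the deduction from
    \<open>C\<close> alone, the cut turns the deduction of \<open>F\<close> from
    \<open>[D, C]\<close> into one from \<open>[C]\<close>, which is exactly what \<open>D\<close>
    asserts.\<close>
  obtain l where l: "0 < l" "F \<in> set (?H l)"
    using deduction_list_cut[OF f \<rho>(1) \<Gamma> i, of j] j by blast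
  then have "holds D"
    unfolding D_def yields_def using holds_entails[OF d \<rho>(1) \<Gamma>(1) F(1)] by blast
  then have "holds C" unfolding C_def D_def using holds_curry_statement by blast
  then have "\<forall>S \<in> set [C]. holds S" by simp
  \<comment> \<open>Stability enters here through the validity of \<rho>: deduction from the true
    \<open>C\<close> is sound, yet it reaches \<open>F\<close>.\<close>
  from deduction_list_holds[OF f valid this, of l] have "\<forall>S \<in> set (?H l). holds S" .
  with l(2) F(2) show False by blast
qed

theorem corollary14p5:
  fixes f :: "nat \<Rightarrow> nat \<times> nat" and deduce :: algorithm
  assumes "recursive_bijection f"
    and "implements_deduce f deduce"
  shows "(\<nexists>\<B>. stable_base \<B> \<and>
      (\<forall>\<rho>. library_over \<B> \<rho> \<longrightarrow>
        (\<forall>A B. is_statement A \<and> is_statement B \<longrightarrow>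
          holds (entails deduce [yields deduce A (Alg \<rho>) B, A] (Alg \<rho>) B)))) \<and>
    (\<forall>P3. implements_P3 deduce P3 \<longrightarrow> (\<nexists>\<B>. stable_base \<B> \<and> P3 \<in> \<B>))"
proof (intro conjI allI impI notI; elim exE conjE)
  fix \<B>
  assume "stable_base \<B>" and "\<forall>\<rho>. library_over \<B> \<rho> \<longrightarrow>
    (\<forall>A B. is_statement A \<and> is_statement B \<longrightarrow>
      holds (entails deduce [yields deduce A (Alg \<rho>) B, A] (Alg \<rho>) B))"
  then show False using no_stable_base_modus_ponens[OF assms, of \<B>] by blast
next
  fix P3 \<B>
  assume P3: "implements_P3 deduce P3" and \<B>: "stable_base \<B>" "P3 \<in> \<B>"
  show False
  \<comment> \<open>Every library over \<B> contains \<open>P3\<close>, so the law holds for all of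
    them and the first part applies.\<close>
  proof (rule no_stable_base_modus_ponens[OF assms \<B>(1)])
    fix \<rho> A B
    assume \<rho>: "library_over \<B> \<rho>" and AB: "is_statement A" "is_statement B"
    have "library \<rho>" "P3 \<in> rules_of \<rho>" using \<rho> \<B>(2) by (auto simp: library_over_def)
    then show "holds (entails deduce [yields deduce A (Alg \<rho>) B, A] (Alg \<rho>) B)"
      using entails_modus_ponens[OF assms P3] AB by blast
  qed
qed

end
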